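(* For every integer $h \geq 2$ there exist $\varepsilon_0(h) > 0$ and a function $f_h : (0,\varepsilon_0(h)) \to \mathbb{R}$ with $f_h(\varepsilon) \to 0$ as $\varepsilon \to 0^+$, and for every $0 < \varepsilon < \varepsilon_0(h)$ there exists $n_0(h,\varepsilon)$, such that the following holds for all integers $n > n_0(h,\varepsilon)$: if $A$ is a set of $n$ real numbers with $$|A.A| \leq n^{1+\varepsilon},$$ then $$|hA| \geq n^{\log(h/2)/(2\log 2) + 1/2 - f_h(\varepsilon)}.$$
   Context: For a finite set $A$ of real numbers, $A.A = \{ab : a,b \in A\}$ is its product set, and $hA = A + A + \cdots + A$ ($h$ summands) is the $h$-fold sumset $\{a_1 + \cdots + a_h : a_i \in A\}$. *)

theory Defs
  imports Complex_Main "HOL-Library.Set_Algebras"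
begin

(* The product set A.A is the elementwise product "A * A" of Set_Algebras.
   Summands of hfold_sumset may coincide: they are indexed by {..<h}, so this is the sumset
   A + ... + A, not the set of sums of h distinct elements, and not the dilate {h * a}. *)

definition hfold_sumset :: "nat \<Rightarrow> real set \<Rightarrow> real set" where
  "hfold_sumset h A = {\<Sum>i<h. a i | a. \<forall>i<h. a i \<in> A}"

lemma hfold_sumset_0: "hfold_sumset 0 A = {0}"
  by (simp add: hfold_sumset_def)

lemma hfold_sumset_Suc: "hfold_sumset (Suc h) A = hfold_sumset h A + A"
proof (rule set_eqI, rule iffI)
  fix x assume "x \<in> hfold_sumset (Suc h) A"
  then obtain a where a: "x = (\<Sum>i<Suc h. a i)" "\<forall>i<Suc h. a i \<in> A"
    unfolding hfold_sumset_def by blast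
  have "(\<Sum>i<h. a i) \<in> hfold_sumset h A" "a h \<in> A"
    using a(2) unfolding hfold_sumset_def by auto
  then show "x \<in> hfold_sumset h A + A"
    using a(1) by (auto intro: set_plus_intro)
next
  fix x assume "x \<in> hfold_sumset h A + A"
  then obtain y z where yz: "x = y + z" "y \<in> hfold_sumset h A" "z \<in> A"
    by (auto elim: set_plus_elim)
  then obtain a where a: "y = (\<Sum>i<h. a i)" "\<forall>i<h. a i \<in> A"
    unfolding hfold_sumset_def by blast
  let ?b = "a(h := z)"
  have "x = (\<Sum>i<Suc h. ?b i)" using yz(1) a(1) by simp
  moreover have "\<forall>i<Suc h. ?b i \<in> A" using a(2) yz(3) by (simp add: less_Suc_eq)
  ultimately show "x \<in> hfold_sumset (Suc h) A"
    unfolding hfold_sumset_def by blast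
qed

end

theory Submission
  imports Defs "HOL-Analysis.Analysis"
begin

text \<open>This iterates Solymosi's geometric argument. Passing to elements of one sign, let \<open>A\<close> consist
  of positive numbers and let \<open>R l = {a \<in> A. l a \<in> A}\<close>. If \<open>|A.A| \<le> K n\<close>, the multiplicative energy
  is at least \<open>n\<^sup>3 / K\<close>, so at least \<open>n / 2K\<close> ratios \<open>l\<close> have \<open>|R l| \<ge> n / 2K\<close>. Each \<open>R l\<close> again has a
  small product set, so inductively \<open>|m (R l)|\<close> is large for \<open>m = 2^k\<close>. The line of slope \<open>l\<close> through the
  origin contains the points \<open>(b, l b)\<close>, \<open>b \<in> m (R l)\<close>, of \<open>mA \<times> mA\<close>. Adding points on neighbouring
  lines shows that \<open>|2mA|\<^sup>2\<close> is at least about \<open>n\<close> times the square of the bound for \<open>m\<close>. Each doubling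
  therefore gains a factor \<open>n^(1/2)\<close>, and \<open>|2^k A| \<ge> n^(1 + k/2 - o(1))\<close>. For \<open>2^k \<le> h < 2^(k+1)\<close> the
  exponent claimed is at most \<open>(k + 1) / 2\<close>, up to \<open>f \<epsilon>\<close>; the spare \<open>n^(1/2)\<close> absorbs the constants.\<close>

section \<open>Iterated sumsets: additivity, monotonicity, dilation\<close>

lemma hfold_sumset_1: "hfold_sumset 1 A = A"
  using hfold_sumset_Suc[of 0 A] by (simp add: hfold_sumset_0)

lemma hfold_sumset_add:
  "hfold_sumset (m + k) A = hfold_sumset m A + hfold_sumset k A"
  by (induction k) (simp_all add: hfold_sumset_0 hfold_sumset_Suc add.assoc)

lemma hfold_sumset_mono: "A \<subseteq> B \<Longrightarrow> hfold_sumset h A \<subseteq> hfold_sumset h B"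
  unfolding hfold_sumset_def by blast

lemma finite_hfold_sumset: "finite A \<Longrightarrow> finite (hfold_sumset h A)"
  by (induction h) (simp_all add: hfold_sumset_0 hfold_sumset_Suc finite_set_plus)

lemma hfold_sumset_nonempty: "A \<noteq> {} \<Longrightarrow> hfold_sumset h A \<noteq> {}"
  by (induction h) (auto simp: hfold_sumset_0 hfold_sumset_Suc set_plus_def)

lemma hfold_sumset_pos:
  assumes "h > 0" "\<And>a. a \<in> A \<Longrightarrow> a > 0" "x \<in> hfold_sumset h A"
  shows "x > 0"
proof -
  obtain a where a: "x = (\<Sum>i<h. a i)" "\<forall>i<h. a i \<in> A"
    using assms(3) unfolding hfold_sumset_def by blast
  show ?thesis
    unfolding a(1) by (rule sum_pos) (use a assms in auto)
qed

lemma hfold_sumset_image_mult: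
  "hfold_sumset h ((\<lambda>a. c * a) ` A) = (\<lambda>x. c * x) ` hfold_sumset h A"
proof (induction h)
  case (Suc h)
  show ?case unfolding hfold_sumset_Suc Suc
    by (auto simp: set_plus_def image_iff distrib_left) (metis distrib_left)+
qed (simp add: hfold_sumset_0)

text \<open>Translation by one fixed element of the \<open>(h - m)\<close>-fold sumset embeds
  \<open>mA\<close> into \<open>hA\<close>.\<close>

lemma card_hfold_sumset_mono:
  assumes "finite A" "A \<noteq> {}" "m \<le> h"
  shows "card (hfold_sumset m A) \<le> card (hfold_sumset h A)"
proof -
  obtain x where x: "x \<in> hfold_sumset (h - m) A"
    using hfold_sumset_nonempty[OF assms(2)] by blast
  have "card (hfold_sumset m A) = card ((\<lambda>y. y + x) ` hfold_sumset m A)"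
    by (intro card_image[symmetric] inj_onI) simp
  also have "\<dots> \<le> card (hfold_sumset (m + (h - m)) A)"
    unfolding hfold_sumset_add using x assms(1)
    by (intro card_mono finite_set_plus finite_hfold_sumset) auto
  finally show ?thesis using assms(3) by simp
qed

section \<open>Sums of points on neighbouring lines\<close>

text \<open>The vector sums of points on two neighbouring lines through the origin lie strictly between
  those lines, so they are distinct for distinct pairs of points.\<close>

lemma card_sumset_ge_of_lines:
  fixes L S :: "real set" and B :: "real \<Rightarrow> real set" and M :: real
  assumes fin: "finite L" "finite S" and M: "M \<ge> 0"
    and card: "\<And>l. l \<in> L \<Longrightarrow> M \<le> real (card (B l))"
    and sub: "\<And>l b. l \<in> L \<Longrightarrow> b \<in> B l \<Longrightarrow> b > 0 \<and> b \<in> S \<and> l * b \<in> S"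
  shows "(real (card L) - 1) * M\<^sup>2 \<le> (real (card (S + S)))\<^sup>2"
proof (cases "L = {}")
  case False
  \<comment> \<open>\<open>s l\<close> is the next larger slope. The steepest line has none, hence
    the \<open>- 1\<close> in the bound.\<close>
  define N where "N = L - {Max L}"
  define s where "s l = Min {m \<in> L. m > l}" for l
  have s: "s l \<in> L" "l < s l" "\<And>m. m \<in> L \<Longrightarrow> l < m \<Longrightarrow> s l \<le> m" if "l \<in> N" for l
  proof -
    have "l < Max L" using that fin(1) unfolding N_def
      by (metis DiffE Max_ge insertI1 order_le_imp_less_or_eq)
    then have ne: "{m \<in> L. m > l} \<noteq> {}" using Max_in[OF fin(1) False] by blast
    show "s l \<in> L" "l < s l" using Min_in[OF _ ne] fin(1) unfolding s_def by auto
    show "s l \<le> m" if "m \<in> L" "l < m" for m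
      unfolding s_def using that fin(1) by (intro Min_le) auto
  qed
  have NL: "N \<subseteq> L" unfolding N_def by blast
  have finB: "finite (B l)" if "l \<in> L" for l
    using sub[OF that] fin(2) by (meson finite_subset subsetI)
  \<comment> \<open>The sum of the points \<open>(b, l * b)\<close> and
    \<open>(c, s l * c)\<close>.\<close>
  define F where "F = (\<lambda>(l, b, c). (b + c, l * b + s l * c))"
  define D where "D = (SIGMA l:N. B l \<times> B (s l))"
  have slope: "l * x < y \<and> y < s l * x"
    if "(l, b, c) \<in> D" "F (l, b, c) = (x, y)" for l b c x y
  proof -
    have l: "l \<in> N" "b > 0" "c > 0" using that(1) NL sub s unfolding D_def by blast+
    have "l * c < s l * c" "l * b < s l * b" using l s(2)[OF l(1)] by simp_all
    then show ?thesis using that(2) unfolding F_def by (auto simp: algebra_simps)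
  qed
  have xpos: "x > 0" if "(l, b, c) \<in> D" "F (l, b, c) = (x, y)" for l b c x y
  proof -
    have "b > 0" "c > 0" using that(1) NL sub s unfolding D_def by blast+
    then show ?thesis using that(2) unfolding F_def by auto
  qed
  \<comment> \<open>The open sectors between successive slopes are disjoint, since
    \<open>l < l'\<close> forces \<open>s l \<le> l'\<close>. A sum therefore determines
    \<open>l\<close>.\<close>
  have not_less: "\<not> l < l'" if "(l, b, c) \<in> D" "(l', b', c') \<in> D" "F (l, b, c) = F (l', b', c')"
    for l b c l' b' c'
  proof
    assume less: "l < l'"
    obtain x y where xy: "F (l, b, c) = (x, y)" by fastforce
    have "l \<in> N" "l' \<in> L" using that(1,2) NL unfolding D_def by auto
    then have "s l \<le> l'" using s(3) less by blast
    moreover have "y < s l * x" "l' * x < y" "x > 0"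
      using slope[OF that(1) xy] slope[OF that(2)] xpos[OF that(1) xy] xy that(3) by auto
    ultimately show False by (smt (verit) mult_right_mono)
  qed
  have inj: "inj_on F D"
  proof (rule inj_onI)
    fix p q assume pq: "p \<in> D" "q \<in> D" "F p = F q"
    obtain l b c l' b' c' where eq: "p = (l, b, c)" "q = (l', b', c')" by (metis prod_cases3)
    note a = pq[unfolded eq]
    have l: "l = l'" using not_less[OF a] not_less[OF a(2,1) a(3)[symmetric]] by linarith
    have e: "b + c = b' + c'" "l * b + s l * c = l * b' + s l * c'"
      using a(3) l unfolding F_def by auto
    \<comment> \<open>For fixed \<open>l\<close> the directions \<open>(1, l)\<close> and
      \<open>(1, s l)\<close> are linearly independent; eliminating \<open>b - b'\<close> isolates
      \<open>c - c'\<close>.\<close>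
    have "(s l - l) * (c - c') = 0" using e by algebra
    moreover have "l < s l" using a(1) s(2) unfolding D_def by auto
    ultimately have "c = c'" by simp
    then show "p = q" using l e eq by simp
  qed
  have "F ` D \<subseteq> (S + S) \<times> (S + S)"
  proof (rule image_subsetI)
    fix p assume p: "p \<in> D"
    obtain l b c where eq: "p = (l, b, c)" by (metis prod_cases3)
    have "l \<in> L" "b \<in> B l" "s l \<in> L" "c \<in> B (s l)"
      using p NL s(1) unfolding D_def eq by auto
    then show "F p \<in> (S + S) \<times> (S + S)"
      using sub unfolding F_def eq by (auto intro!: set_plus_intro)
  qed
  then have "card (F ` D) \<le> card ((S + S) \<times> (S + S))"
    using fin by (intro card_mono) (auto intro: finite_set_plus)
  then have le: "card D \<le> (card (S + S))\<^sup>2"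
    by (simp add: card_image[OF inj] card_cartesian_product power2_eq_square)
  have "real (card D) = (\<Sum>l\<in>N. real (card (B l)) * real (card (B (s l))))"
    unfolding D_def using fin(1) NL finB s(1)
    by (subst card_SigmaI) (auto simp: card_cartesian_product N_def)
  also have "\<dots> \<ge> (\<Sum>l\<in>N. M * M)"
    using M card s(1) NL by (intro sum_mono mult_mono) auto
  finally have "real (card N) * M\<^sup>2 \<le> real (card D)" by (simp add: power2_eq_square)
  moreover have "real (card N) = real (card L) - 1"
    unfolding N_def using fin(1) False
    by (simp add: card_Diff_singleton Max_in of_nat_diff Suc_leI card_gt_0_iff)
  ultimately show ?thesis using le by (metis of_nat_le_iff of_nat_power order_trans)
qed (use M in simp)

section \<open>Popular ratios from multiplicative energy\<close>

text \<open>The energy is the sum of \<open>(r l)\<^sup>2\<close> over all ratios. Ratios with fewer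
  than \<open>n / 2K\<close> representations contribute at most half of
  \<open>n\<^sup>3 / K\<close>, and each remaining one at most \<open>n\<^sup>2\<close>, so many
  must remain.\<close>

lemma card_popular_ratios_ge:
  fixes A :: "real set" and K :: real
  defines "R \<equiv> \<lambda>l. {a \<in> A. l * a \<in> A}"
  assumes fin: "finite A" and ne: "A \<noteq> {}" and pos: "\<And>a. a \<in> A \<Longrightarrow> a > 0"
    and K: "K > 0" "real (card (A * A)) \<le> K * real (card A)"
  obtains L where "finite L" "\<And>l. l \<in> L \<Longrightarrow> l > 0"
    "\<And>l. l \<in> L \<Longrightarrow> real (card A) / (2 * K) \<le> real (card (R l))"
    "real (card A) / (2 * K) \<le> real (card L)"
proof -
  define n where "n = real (card A)"
  define Q where "Q = (\<lambda>(a, b). b / a) ` (A \<times> A)"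
  define r where "r l = real (card (R l))" for l
  define F where "F x = {p \<in> A \<times> A. fst p * snd p = x}" for x
  define L where "L = {l \<in> Q. n / (2 * K) \<le> r l}"
  have npos: "n > 0" unfolding n_def using fin ne by (simp add: card_gt_0_iff)
  have finQ: "finite Q" unfolding Q_def using fin by simp
  have Qpos: "l > 0" if "l \<in> Q" for l using that pos unfolding Q_def by auto
  have finR: "finite (R l)" for l unfolding R_def using fin by simp
  have finF: "finite (F x)" for x unfolding F_def using fin by simp
  have finAA: "finite (A * A)" using fin by (rule finite_set_times[OF _ fin])
  have "(\<Sum>x\<in>A * A. real (card (F x))) = real (card (SIGMA x:A * A. F x))"
    using finAA finF by simp
  also have "\<dots> \<ge> real (card (A \<times> A))"
  proof -
    have "A \<times> A \<subseteq> snd ` (SIGMA x:A * A. F x)"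
      unfolding F_def by (force intro: set_times_intro)
    then show ?thesis
      using finAA finF by (intro of_nat_mono surj_card_le) auto
  qed
  finally have sumF: "n\<^sup>2 \<le> (\<Sum>x\<in>A * A. real (card (F x)))"
    by (simp add: n_def card_cartesian_product power2_eq_square)
  \<comment> \<open>For positive numbers \<open>a b = c d\<close> means \<open>c / a = b / d\<close>, so the energy also counts pairs with equal ratio.\<close>
  define G where "G = (\<lambda>(x::real, (a, b::real), (c, d::real)). (c / a :: real, a :: real, d))"
  have nz: "a \<noteq> 0" if "a \<in> A" for a using pos[OF that] by simp
  \<comment> \<open>The inverse: \<open>c\<close> is the ratio times \<open>a\<close>, then
    \<open>x = c * d\<close> and \<open>b = x / a\<close>.\<close>
  have injG: "inj_on G (SIGMA x:A * A. F x \<times> F x)"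
    unfolding G_def F_def by (rule inj_onI) (auto simp: nz)
  have subG: "G ` (SIGMA x:A * A. F x \<times> F x) \<subseteq> (SIGMA l:Q. R l \<times> R l)"
  proof (rule image_subsetI)
    fix p assume p: "p \<in> (SIGMA x:A * A. F x \<times> F x)"
    obtain x a b c d where eq: "p = (x, (a, b), (c, d))" by (metis prod.exhaust)
    have m: "a \<in> A" "b \<in> A" "c \<in> A" "d \<in> A" "a * b = c * d"
      using p unfolding F_def eq by auto
    have "c / a * a = c" "c / a * d = b" using pos[OF m(1)] m(5) by (auto simp: field_simps)
    then show "G p \<in> (SIGMA l:Q. R l \<times> R l)"
      using m unfolding G_def eq Q_def R_def by force
  qed
  have "(\<Sum>x\<in>A * A. (real (card (F x)))\<^sup>2) = real (card (SIGMA x:A * A. F x \<times> F x))"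
    using finAA finF by (simp add: card_cartesian_product power2_eq_square)
  also have "\<dots> \<le> real (card (SIGMA l:Q. R l \<times> R l))"
    using card_inj_on_le[OF injG subG] finQ finR by (intro of_nat_mono) blast
  also have "\<dots> = (\<Sum>l\<in>Q. (r l)\<^sup>2)"
    unfolding r_def using finQ finR by (simp add: card_cartesian_product power2_eq_square)
  finally have energy: "(\<Sum>x\<in>A * A. (real (card (F x)))\<^sup>2) \<le> (\<Sum>l\<in>Q. (r l)\<^sup>2)" .
  \<comment> \<open>Cauchy-Schwarz over the products \<open>x\<close>, of which there are at most
    \<open>K * n\<close>.\<close>
  have "(n\<^sup>2)\<^sup>2 \<le> (\<Sum>x\<in>A * A. real (card (F x)))\<^sup>2"
    using sumF by (intro power_mono) simp_all
  also have "\<dots> \<le> real (card (A * A)) * (\<Sum>x\<in>A * A. (real (card (F x)))\<^sup>2)"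
    using sum_squared_le_sum_of_squares[of "\<lambda>x. real (card (F x))" "A * A"] by (simp add: mult.commute)
  also have "\<dots> \<le> (K * n) * (\<Sum>l\<in>Q. (r l)\<^sup>2)"
    using K energy npos unfolding n_def by (intro mult_mono) (auto intro: sum_nonneg)
  finally have "n * n^3 \<le> n * (K * (\<Sum>l\<in>Q. (r l)\<^sup>2))"
    by (simp add: power2_eq_square power3_eq_cube algebra_simps)
  then have low: "n^3 \<le> K * (\<Sum>l\<in>Q. (r l)\<^sup>2)" using npos by simp
  have rn: "0 \<le> r l" "r l \<le> n" for l
    unfolding r_def n_def R_def using fin by (auto intro!: card_mono)
  have sumr: "(\<Sum>l\<in>Q. r l) \<le> n\<^sup>2"
  proof -
    \<comment> \<open>A pair \<open>(a, l * a)\<close> determines \<open>l\<close>, because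
      \<open>0\<close> is not in \<open>A\<close>.\<close>
    have "inj_on (\<lambda>(l, a). (a, l * a)) (SIGMA l:Q. R l)"
      by (rule inj_onI) (use pos[of 0] in \<open>auto simp: R_def\<close>)
    moreover have "(\<lambda>(l, a). (a, l * a)) ` (SIGMA l:Q. R l) \<subseteq> A \<times> A"
      by (auto simp: R_def)
    ultimately have "card (SIGMA l:Q. R l) \<le> card (A \<times> A)"
      using fin by (intro card_inj_on_le) auto
    then have "real (card (SIGMA l:Q. R l)) \<le> real (card (A \<times> A))" by simp
    then show ?thesis unfolding r_def n_def using finQ finR
      by (simp add: card_cartesian_product power2_eq_square)
  qed
  \<comment> \<open>One factor \<open>r l\<close> is bounded by the threshold for unpopular ratios;
    both are bounded by \<open>n\<close> for popular ones.\<close>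
  have "(\<Sum>l\<in>Q. (r l)\<^sup>2) \<le> (\<Sum>l\<in>Q. n / (2 * K) * r l + (if l \<in> L then n\<^sup>2 else 0))"
  proof (rule sum_mono)
    fix l assume "l \<in> Q"
    show "(r l)\<^sup>2 \<le> n / (2 * K) * r l + (if l \<in> L then n\<^sup>2 else 0)"
    proof (cases "l \<in> L")
      case True
      have "(r l)\<^sup>2 \<le> n\<^sup>2" using rn by (intro power_mono) auto
      moreover have "0 \<le> n / (2 * K) * r l" using rn npos K by simp
      ultimately show ?thesis using True by simp
    next
      case False
      then have "r l \<le> n / (2 * K)" using \<open>l \<in> Q\<close> unfolding L_def by auto
      then have "r l * r l \<le> n / (2 * K) * r l" using rn(1) by (rule mult_right_mono)
      then show ?thesis using False by (simp add: power2_eq_square)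
    qed
  qed
  also have "\<dots> = n / (2 * K) * (\<Sum>l\<in>Q. r l) + real (card L) * n\<^sup>2"
  proof -
    have "Q \<inter> L = L" unfolding L_def by blast
    then show ?thesis using finQ
      by (simp add: sum.distrib sum_distrib_left sum.If_cases)
  qed
  also have "\<dots> \<le> n / (2 * K) * n\<^sup>2 + real (card L) * n\<^sup>2"
    using sumr npos K by (intro add_right_mono mult_left_mono) auto
  finally have "n^3 \<le> K * (n / (2 * K) * n\<^sup>2 + real (card L) * n\<^sup>2)"
    using low K(1) by (smt (verit) mult_left_mono)
  also have "\<dots> = n^3 / 2 + K * real (card L) * n\<^sup>2"
    using K(1) by (simp add: field_simps power2_eq_square power3_eq_cube)
  finally have "n\<^sup>2 * n \<le> n\<^sup>2 * (2 * K * real (card L))"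
    by (simp add: algebra_simps power2_eq_square power3_eq_cube)
  then have "n \<le> 2 * K * real (card L)" using npos by simp
  then have "n / (2 * K) \<le> real (card L)" using K(1) by (simp add: field_simps)
  then show thesis
    using finQ Qpos by (intro that[of L]) (auto simp: L_def n_def r_def)
qed

section \<open>Induction on the number of doublings\<close>

text \<open>The exponent \<open>e\<close> depends on \<open>k\<close> alone, and \<open>A\<close>
  and \<open>K\<close> stay quantified, because the induction hypothesis is applied to the sets
  \<open>R l\<close> with \<open>2 * K\<^sup>2\<close> for \<open>K\<close>. Squaring avoids
  half-integer powers of \<open>n\<close>.\<close>

lemma card_iterated_sumset_ge:
  "\<exists>e::nat. \<forall>(A::real set) K. finite A \<longrightarrow> (\<forall>a\<in>A. a > 0) \<longrightarrow> K \<ge> 1 \<longrightarrow>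
    real (card (A * A)) \<le> K * real (card A) \<longrightarrow>
    real (card A) ^ (k + 2) \<le> (4 * K) ^ e * (real (card (hfold_sumset (2 ^ k) A)))\<^sup>2"
proof (induction k)
  case 0
  show ?case by (rule exI[of _ 0]) (simp add: hfold_sumset_1[unfolded One_nat_def] power2_eq_square)
next
  case (Suc k)
  then obtain e where IH: "\<And>(A::real set) K. \<lbrakk>finite A; \<forall>a\<in>A. a > 0; K \<ge> 1;
      real (card (A * A)) \<le> K * real (card A)\<rbrakk> \<Longrightarrow>
      real (card A) ^ (k + 2) \<le> (4 * K) ^ e * (real (card (hfold_sumset (2 ^ k) A)))\<^sup>2"
    by blast
  show ?case
  \<comment> \<open>The part \<open>2 * e\<close> comes from
    \<open>4 * (2 * K\<^sup>2) \<le> (4 * K)\<^sup>2\<close> in the induction hypothesis. Of the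
    \<open>k + 3\<close> losses of \<open>4 * K\<close>, one is for the number of lines and
    \<open>k + 2\<close> are for the size of \<open>R l\<close>.\<close>
  proof (intro exI[of _ "2 * e + (k + 3)"] allI impI)
    fix A :: "real set" and K :: real
    assume fin: "finite A" and pos: "\<forall>a\<in>A. a > 0" and K: "K \<ge> 1"
      and AA: "real (card (A * A)) \<le> K * real (card A)"
    define n where "n = real (card A)"
    define H where "H = hfold_sumset (2 ^ k) A"
    define T where "T = real (card (hfold_sumset (2 ^ Suc k) A))"
    have T: "T = real (card (H + H))"
      unfolding T_def H_def by (simp add: hfold_sumset_add[symmetric] mult_2)
    show "real (card A) ^ (Suc k + 2) \<le> (4 * K) ^ (2 * e + (k + 3)) * T\<^sup>2"
    \<comment> \<open>For small \<open>n\<close> the constant alone exceeds the left side, as a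
      nonempty sumset has \<open>T \<ge> 1\<close>.\<close>
    proof (cases "n < 4 * K")
      case True
      show ?thesis
      proof (cases "A = {}")
        case False
        have "card (hfold_sumset (2 ^ Suc k) A) \<ge> 1"
          using hfold_sumset_nonempty[OF False] finite_hfold_sumset[OF fin]
          by (simp add: Suc_leI card_gt_0_iff)
        then have "T\<^sup>2 \<ge> 1" unfolding T_def by (simp add: one_le_power)
        moreover have "n ^ (k + 3) \<le> (4 * K) ^ (k + 3)"
          using True by (intro power_mono) (auto simp: n_def)
        moreover have "(4 * K) ^ (k + 3) \<le> (4 * K) ^ (2 * e + (k + 3))"
          using K by (intro power_increasing) auto
        ultimately have "n ^ (k + 3) * 1 \<le> (4 * K) ^ (2 * e + (k + 3)) * T\<^sup>2"
          using K by (intro mult_mono) (auto simp: n_def)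
        then show ?thesis by (simp add: n_def numeral_3_eq_3)
      qed (use K in simp)
    next
      case False
      have ne: "A \<noteq> {}" using False K by (auto simp: n_def)
      obtain L where L: "finite L" "\<And>l. l \<in> L \<Longrightarrow> l > 0"
        "\<And>l. l \<in> L \<Longrightarrow> n / (2 * K) \<le> real (card {a \<in> A. l * a \<in> A})"
        "n / (2 * K) \<le> real (card L)"
        using card_popular_ratios_ge[OF fin ne _ _ AA] pos K unfolding n_def by auto
      define R where "R l = {a \<in> A. l * a \<in> A}" for l
      \<comment> \<open>The lower bound, uniform in \<open>l\<close>, that the induction hypothesis
        gives for the \<open>2 ^ k\<close>-fold sumset of \<open>R l\<close>.\<close>
      define M where "M = sqrt ((n / (2 * K)) ^ (k + 2) / (4 * K) ^ (2 * e))"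
      have n0: "n > 0" using False K by linarith
      have M2: "M\<^sup>2 = (n / (2 * K)) ^ (k + 2) / (4 * K) ^ (2 * e)"
        unfolding M_def using n0 K by simp
      have MR: "M \<le> real (card (hfold_sumset (2 ^ k) (R l)))" if l: "l \<in> L" for l
      proof -
        let ?c = "real (card (hfold_sumset (2 ^ k) (R l)))"
        have "card (R l * R l) \<le> card (A * A)"
          using fin by (intro card_mono finite_set_times set_times_mono2) (auto simp: R_def)
        then have "real (card (R l * R l)) \<le> K * n" using AA by (simp add: n_def)
        also have "\<dots> = 2 * K\<^sup>2 * (n / (2 * K))" using K by (simp add: power2_eq_square)
        also have "\<dots> \<le> 2 * K\<^sup>2 * real (card (R l))"
          using L(3)[OF l] unfolding R_def by (intro mult_left_mono) auto
        finally have "real (card (R l)) ^ (k + 2) \<le> (4 * (2 * K\<^sup>2)) ^ e * ?c\<^sup>2"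
          using fin pos order_trans[OF one_le_power[OF K, of 2], of "2 * K\<^sup>2"]
          by (intro IH) (auto simp: R_def)
        also have "\<dots> \<le> ((4 * K)\<^sup>2) ^ e * ?c\<^sup>2"
          by (intro mult_right_mono power_mono) (auto simp: power_mult_distrib)
        finally have "real (card (R l)) ^ (k + 2) \<le> (4 * K) ^ (2 * e) * ?c\<^sup>2"
          by (simp add: power_mult)
        moreover have "(n / (2 * K)) ^ (k + 2) \<le> real (card (R l)) ^ (k + 2)"
          using L(3)[OF l] n0 K unfolding R_def by (intro power_mono) auto
        ultimately have "(n / (2 * K)) ^ (k + 2) \<le> (4 * K) ^ (2 * e) * ?c\<^sup>2" by linarith
        then have "M\<^sup>2 \<le> ?c\<^sup>2"
          unfolding M2 using K by (subst pos_divide_le_eq) (simp_all only: mult.commute, simp)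
        then show ?thesis by (rule power2_le_imp_le) simp
      qed
      have lines: "(real (card L) - 1) * M\<^sup>2 \<le> (real (card (H + H)))\<^sup>2"
      proof (rule card_sumset_ge_of_lines[OF L(1) _ _ MR])
        show "finite H" unfolding H_def using fin by (rule finite_hfold_sumset)
        show "M \<ge> 0" unfolding M_def using n0 K by simp
        fix l b assume l: "l \<in> L" and b: "b \<in> hfold_sumset (2 ^ k) (R l)"
        have "b > 0" by (rule hfold_sumset_pos[OF _ _ b]) (use pos in \<open>auto simp: R_def\<close>)
        moreover have "b \<in> H"
          using b hfold_sumset_mono[of "R l" A] unfolding H_def R_def by blast
        \<comment> \<open>By definition of \<open>R l\<close> its dilate by \<open>l\<close> lies in
          \<open>A\<close>, and dilation commutes with sumsets.\<close>
        moreover have "l * b \<in> hfold_sumset (2 ^ k) ((\<lambda>a. l * a) ` R l)"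
          unfolding hfold_sumset_image_mult using b by (rule imageI)
        then have "l * b \<in> H"
          using hfold_sumset_mono[of "(\<lambda>a. l * a) ` R l" A] unfolding H_def R_def by blast
        ultimately show "b > 0 \<and> b \<in> H \<and> l * b \<in> H" by blast
      qed
      \<comment> \<open>Since \<open>x - 1 \<ge> x / 2\<close> for \<open>x \<ge> 2\<close>, giving
        up one line costs at most a factor \<open>2\<close>.\<close>
      have "2 \<le> n / (2 * K)" using False K by (simp add: field_simps)
      moreover have "n / (4 * K) = n / (2 * K) / 2" by simp
      ultimately have L1: "n / (4 * K) \<le> real (card L) - 1" using L(4) by linarith
      have "n ^ (k + 3) / (4 * K) ^ (2 * e + (k + 3))
          = n / (4 * K) * ((n / (4 * K)) ^ (k + 2) / (4 * K) ^ (2 * e))"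
        by (simp add: power_add power_divide numeral_3_eq_3 power2_eq_square)
      also have "\<dots> \<le> n / (4 * K) * M\<^sup>2"
        unfolding M2 using n0 K
        by (intro mult_left_mono divide_right_mono power_mono divide_left_mono) auto
      also have "\<dots> \<le> (real (card L) - 1) * M\<^sup>2" using L1 by (intro mult_right_mono) auto
      also have "\<dots> \<le> T\<^sup>2" using lines T by simp
      finally show ?thesis
        using K by (simp add: n_def divide_le_eq mult.commute numeral_3_eq_3)
    qed
  qed
qed

section \<open>Reduction to positive numbers and conclusion\<close>

text \<open>The larger of the positive and negative parts serves, with \<open>c\<close> equal to
  \<open>1\<close> or \<open>-1\<close>. As \<open>card B \<ge> 1\<close>, a possible zero is
  absorbed: \<open>1 + 2 * card B \<le> 4 * card B\<close>.\<close>

lemma obtain_positive_dilate: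
  fixes A :: "real set"
  assumes fin: "finite A" and card: "card A \<ge> 2"
  obtains B c where "finite B" "B \<noteq> {}" "\<forall>b\<in>B. b > 0" "c \<noteq> 0" "(\<lambda>b. c * b) ` B \<subseteq> A"
    "real (card A) \<le> 4 * real (card B)"
proof -
  define P where "P = {a \<in> A. a > 0}"
  define N where "N = {a \<in> A. a < 0}"
  have "A \<subseteq> insert 0 (P \<union> N)" unfolding P_def N_def by auto
  then have "card A \<le> card (insert 0 (P \<union> N))"
    using fin by (intro card_mono) (auto simp: P_def N_def)
  also have "\<dots> \<le> Suc (card (P \<union> N))" by (rule card_insert_le_m1) simp_all
  also have "\<dots> \<le> Suc (card P + card N)" using card_Un_le by simp
  finally have c: "card A \<le> Suc (card P + card N)" .
  have N: "card (uminus ` N) = card N" by (intro card_image inj_onI) simp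
  show thesis
  proof (cases "card P \<ge> card N")
    case True
    then have "card P > 0" using c card by linarith
    then have "P \<noteq> {}" by auto
    with True show thesis using c card fin
      by (intro that[of P 1]) (simp_all add: P_def)
  next
    case False
    then have "card N > 0" using c card by linarith
    then have "N \<noteq> {}" by auto
    with False show thesis using c card fin N
      by (intro that[of "uminus ` N" "-1"]) (simp_all add: N_def image_image)
  qed
qed

theorem theorem1:
  shows "\<forall>h::nat. h \<ge> 2 \<longrightarrow>
    (\<exists>(\<epsilon>\<^sub>0::real) (f :: real \<Rightarrow> real). \<epsilon>\<^sub>0 > 0 \<and> (f \<longlongrightarrow> 0) (at_right 0) \<and>
      (\<forall>\<epsilon>::real. 0 < \<epsilon> \<and> \<epsilon> < \<epsilon>\<^sub>0 \<longrightarrow>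
        (\<exists>n\<^sub>0::nat. \<forall>n::nat. n > n\<^sub>0 \<longrightarrow>
          (\<forall>A :: real set. finite A \<and> card A = n \<and>
             real (card (A * A)) \<le> real n powr (1 + \<epsilon>) \<longrightarrow>
             real (card (hfold_sumset h A))
               \<ge> real n powr (ln (real h / 2) / (2 * ln 2) + 1 / 2 - f \<epsilon>)))))"
proof (intro allI impI)
  fix h :: nat assume h: "h \<ge> 2"
  obtain k where k: "2 ^ k \<le> h" "h < 2 ^ (k + 1)"
    using ex_power_ivl1[of 2 h] h by auto
  obtain e where e: "\<And>(A::real set) K. \<lbrakk>finite A; \<forall>a\<in>A. a > 0; K \<ge> 1;
      real (card (A * A)) \<le> K * real (card A)\<rbrakk> \<Longrightarrow>
      real (card A) ^ (k + 2) \<le> (4 * K) ^ e * (real (card (hfold_sumset (2 ^ k) A)))\<^sup>2"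
    using card_iterated_sumset_ge[of k] by blast
  \<comment> \<open>With \<open>K\<close> proportional to \<open>n powr \<epsilon>\<close>, the loss
    \<open>(4 * K) ^ e\<close> is \<open>n powr (e * \<epsilon>)\<close> up to a constant; the
    square root halves the exponent.\<close>
  define f where "f \<epsilon> = real e * \<epsilon> / 2" for \<epsilon> :: real
  define E where "E = ln (real h / 2) / (2 * ln 2) + 1 / 2"
  \<comment> \<open>\<open>2 * E\<close> is the binary logarithm of \<open>h\<close>.\<close>
  have "real h \<le> real (2 ^ (k + 1))" using k(2) by (intro of_nat_mono) simp
  then have "ln (real h) \<le> ln (2 ^ (k + 1))" using h by (subst ln_le_cancel_iff) auto
  then have "ln (real h) \<le> (real k + 1) * ln 2" by (simp add: ln_realpow ln_mult algebra_simps)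
  then have E: "2 * E \<le> real k + 1"
    unfolding E_def using h by (simp add: ln_div field_simps)
  have main: "real n powr (E - f \<epsilon>) \<le> real (card (hfold_sumset h A))"
    if eps: "\<epsilon> > 0" and n: "n > 16 ^ e * 4 ^ (k + 2)" and A: "finite A" "card A = n"
      and AA: "real (card (A * A)) \<le> real n powr (1 + \<epsilon>)" for \<epsilon> n A
  proof -
    have "(1::nat) * 4 ^ 1 \<le> 16 ^ e * 4 ^ (k + 2)"
      by (intro mult_mono power_increasing) auto
    from le_less_trans[OF this n] have n4: "n > 4" by simp
    obtain B c where B: "finite B" "B \<noteq> {}" "\<forall>b\<in>B. b > 0" "c \<noteq> 0" "(\<lambda>b. c * b) ` B \<subseteq> A"
      "real n \<le> 4 * real (card B)"
      using obtain_positive_dilate[of A] A n4 by auto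
    \<comment> \<open>The factor \<open>4\<close> compensates for \<open>B\<close> having possibly
      only \<open>n / 4\<close> elements.\<close>
    define K where "K = 4 * real n powr \<epsilon>"
    define T where "T = real (card (hfold_sumset h A))"
    have "real n powr \<epsilon> \<ge> 1" using n4 eps by (intro ge_one_powr_ge_zero) auto
    then have K: "K \<ge> 1" unfolding K_def by simp
    have inj: "inj_on (\<lambda>b. c * b) X" for X using B(4) by (intro inj_onI) simp
    \<comment> \<open>Multiplication by \<open>c\<^sup>2\<close> embeds \<open>B * B\<close> into
      \<open>A * A\<close>.\<close>
    have "card (B * B) = card ((\<lambda>b. c\<^sup>2 * b) ` (B * B))"
      using B(4) by (intro card_image[symmetric] inj_onI) simp
    also have "\<dots> \<le> card (A * A)"
    proof (rule card_mono)
      have "c\<^sup>2 * (x * y) \<in> A * A" if "x \<in> B" "y \<in> B" for x y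
      proof -
        have "c * x \<in> A" "c * y \<in> A" using B(5) that by blast+
        then have "(c * x) * (c * y) \<in> A * A" by (rule set_times_intro)
        then show ?thesis by (simp add: power2_eq_square mult_ac)
      qed
      then show "(\<lambda>b. c\<^sup>2 * b) ` (B * B) \<subseteq> A * A"
        by (auto elim!: set_times_elim)
    qed (use A in \<open>simp add: finite_set_times\<close>)
    finally have "real (card (B * B)) \<le> real n powr (1 + \<epsilon>)" using AA by simp
    also have "\<dots> = real n powr \<epsilon> * real n" using n4 by (simp add: powr_add)
    also have "\<dots> \<le> K * real (card B)"
      unfolding K_def using mult_left_mono[OF B(6), of "real n powr \<epsilon>"] by (simp add: mult_ac)
    finally have *: "real (card B) ^ (k + 2) \<le> (4 * K) ^ e * (real (card (hfold_sumset (2 ^ k) B)))\<^sup>2"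
      using e B K by blast
    have "card (hfold_sumset (2 ^ k) B) \<le> card (hfold_sumset h B)"
      using B k by (intro card_hfold_sumset_mono) auto
    also have "\<dots> = card (hfold_sumset h ((\<lambda>b. c * b) ` B))"
      unfolding hfold_sumset_image_mult by (rule card_image[OF inj, symmetric])
    also have "\<dots> \<le> card (hfold_sumset h A)"
      using A B by (intro card_mono finite_hfold_sumset hfold_sumset_mono)
    finally have "real (card (hfold_sumset (2 ^ k) B)) \<le> T" unfolding T_def by simp
    then have "(4 * K) ^ e * (real (card (hfold_sumset (2 ^ k) B)))\<^sup>2 \<le> (4 * K) ^ e * T\<^sup>2"
      using K by (intro mult_left_mono power_mono) auto
    moreover have "real n ^ (k + 2) \<le> 4 ^ (k + 2) * real (card B) ^ (k + 2)"
      using B(6) unfolding power_mult_distrib[symmetric] by (intro power_mono) auto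
    ultimately have "real n ^ (k + 2) \<le> 4 ^ (k + 2) * ((4 * K) ^ e * T\<^sup>2)"
      using * by (smt (verit) mult_left_mono zero_le_power)
    also have "(4 * K) ^ e = 16 ^ e * real n powr (real e * \<epsilon>)"
      unfolding K_def using n4
      by (simp add: power_mult_distrib powr_power mult.commute flip: mult.assoc)
    finally have "real n * real n ^ (k + 1)
        \<le> real (16 ^ e * 4 ^ (k + 2)) * (real n powr (real e * \<epsilon>) * T\<^sup>2)"
      by (simp add: mult_ac)
    \<comment> \<open>One of the \<open>k + 2\<close> factors \<open>n\<close> pays for all
      constants; this fixes the threshold for \<open>n\<close>.\<close>
    also have "\<dots> \<le> real n * (real n powr (real e * \<epsilon>) * T\<^sup>2)"
      using n by (intro mult_right_mono) (simp_all only: of_nat_le_iff, auto)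
    finally have 1: "real n ^ (k + 1) \<le> real n powr (real e * \<epsilon>) * T\<^sup>2" using n4 by simp
    have "(real n powr (E - f \<epsilon>))\<^sup>2 = real n powr (2 * E - real e * \<epsilon>)"
      using n4 by (simp add: powr_power f_def algebra_simps)
    also have "\<dots> \<le> real n powr (real (k + 1) - real e * \<epsilon>)"
      using E n4 by (intro powr_mono) auto
    also have "\<dots> = real n ^ (k + 1) / real n powr (real e * \<epsilon>)"
      unfolding powr_diff using n4 by (subst powr_realpow) auto
    also have "\<dots> \<le> T\<^sup>2" using 1 n4 by (simp add: divide_le_eq mult.commute)
    finally have "real n powr (E - f \<epsilon>) \<le> T" by (rule power2_le_imp_le) (simp add: T_def)
    then show ?thesis unfolding T_def .
  qed
  have "(f \<longlongrightarrow> 0) (at_right 0)" unfolding f_def by (auto intro!: tendsto_eq_intros)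
  then show "\<exists>(\<epsilon>\<^sub>0::real) (f :: real \<Rightarrow> real). \<epsilon>\<^sub>0 > 0 \<and> (f \<longlongrightarrow> 0) (at_right 0) \<and>
      (\<forall>\<epsilon>::real. 0 < \<epsilon> \<and> \<epsilon> < \<epsilon>\<^sub>0 \<longrightarrow>
        (\<exists>n\<^sub>0::nat. \<forall>n::nat. n > n\<^sub>0 \<longrightarrow>
          (\<forall>A :: real set. finite A \<and> card A = n \<and>
             real (card (A * A)) \<le> real n powr (1 + \<epsilon>) \<longrightarrow>
             real (card (hfold_sumset h A))
               \<ge> real n powr (ln (real h / 2) / (2 * ln 2) + 1 / 2 - f \<epsilon>))))"
    using main unfolding E_def
    by (intro exI[of _ 1] exI[of _ f] conjI allI impI exI[of _ "16 ^ e * 4 ^ (k + 2)"]) auto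
qed

end
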